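(* Consider the RoPE spherical self-attention flow on $(\mathbb{S}^{d-1})^n$, and let $x_i=x^\star$ ($i=1,\dots,n$), $x^\star\in\mathbb{S}^{d-1}$, be a consensus equilibrium. Let $A^\star$, $Z_i^\star$ denote the attention matrix and degrees at this point. For tangent perturbations $\xi_i\in T_{x^\star}\mathbb{S}^{d-1}$, the tangent linearization of the flow is $$\dot\xi_i=\sum_{j=1}^{n}A^\star_{ij}\xi_j-\xi_i,\qquad i=1,\dots,n.$$ In a common orthonormal basis of $T_{x^\star}\mathbb{S}^{d-1}$, the Jacobian is $$J_{\mathcal C}=(A^\star-I_n)\otimes I_{d-1}.$$ Along this fixed linear system, the stationary-weighted tangent mean $$\bar\xi_\pi=\sum_i\pi_i^\star\xi_i,\qquad \pi_i^\star=\frac{Z_i^\star}{\sum_kZ_k^\star},$$ is conserved.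
   Context: Let $n\ge2$ and $d=2r$ with $r\ge1$. Token $i$ has a fixed position $p_i\in\mathbb{R}$ and state $x_i\in\mathbb{S}^{d-1}$. For real frequencies $\omega_1,\dots,\omega_r$, define the block rotation $R_p=\bigoplus_{\ell=1}^r\begin{pmatrix}\cos(\omega_\ell p)&-\sin(\omega_\ell p)\\ \sin(\omega_\ell p)&\cos(\omega_\ell p)\end{pmatrix}$. For finite $\beta\ge0$: $s_{ij}(x)=\langle R_{p_i}x_i,R_{p_j}x_j\rangle$, $W_{ij}(x)=e^{\beta s_{ij}(x)}$, $Z_i(x)=\sum_kW_{ik}(x)$, $A_{ij}(x)=W_{ij}(x)/Z_i(x)$. The flow is $\dot x_i=F_i(x)=\sum_{j=1}^nA_{ij}(x)(x_j-\langle x_i,x_j\rangle x_i)$. Every consensus state $(x^\star,\dots,x^\star)$ is an equilibrium; the tangent linearization is the derivative of the vector field $F$ at this equilibrium restricted to $(T_{x^\star}\mathbb{S}^{d-1})^n$, where $T_{x^\star}\mathbb{S}^{d-1}=\{\xi\in\mathbb{R}^d:\langle\xi,x^\star\rangle=0\}$. *)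

theory Defs
  imports "HOL-Analysis.Analysis"
begin

text \<open>
  The state space \<open>\<real>\<^sup>d\<close> with \<open>d = 2r\<close> is \<open>real^('r \<times> 2)\<close>, where \<open>CARD('r) = r\<close>; the coordinate
  \<open>(l, a)\<close> is the \<open>a\<close>-th coordinate of the \<open>l\<close>-th planar block.  A configuration of the tokens
  is an element of \<open>(real^('r \<times> 2))^'n\<close>, where \<open>CARD('n) = n\<close>.
\<close>

definition planar_rotation :: "real \<Rightarrow> real^2^2" where
  "planar_rotation \<theta> = vector [vector [cos \<theta>, - sin \<theta>], vector [sin \<theta>, cos \<theta>]]"

definition rope_rotation :: "('r::finite \<Rightarrow> real) \<Rightarrow> real \<Rightarrow> real^('r \<times> 2)^('r \<times> 2)" where
  "rope_rotation \<omega> p =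
    (\<chi> u v. if fst u = fst v then planar_rotation (\<omega> (fst u) * p) $ snd u $ snd v else 0)"

definition rope_score ::
    "('r::finite \<Rightarrow> real) \<Rightarrow> ('n::finite \<Rightarrow> real) \<Rightarrow> (real^('r \<times> 2))^'n \<Rightarrow> 'n \<Rightarrow> 'n \<Rightarrow> real" where
  "rope_score \<omega> p x i j =
    (rope_rotation \<omega> (p i) *v (x $ i)) \<bullet> (rope_rotation \<omega> (p j) *v (x $ j))"

definition rope_weight ::
    "real \<Rightarrow> ('r::finite \<Rightarrow> real) \<Rightarrow> ('n::finite \<Rightarrow> real) \<Rightarrow> (real^('r \<times> 2))^'n \<Rightarrow> 'n \<Rightarrow> 'n \<Rightarrow> real" where
  "rope_weight \<beta> \<omega> p x i j = exp (\<beta> * rope_score \<omega> p x i j)"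

definition rope_degree ::
    "real \<Rightarrow> ('r::finite \<Rightarrow> real) \<Rightarrow> ('n::finite \<Rightarrow> real) \<Rightarrow> (real^('r \<times> 2))^'n \<Rightarrow> 'n \<Rightarrow> real" where
  "rope_degree \<beta> \<omega> p x i = (\<Sum>k\<in>UNIV. rope_weight \<beta> \<omega> p x i k)"

definition rope_attention ::
    "real \<Rightarrow> ('r::finite \<Rightarrow> real) \<Rightarrow> ('n::finite \<Rightarrow> real) \<Rightarrow> (real^('r \<times> 2))^'n \<Rightarrow> real^'n^'n" where
  "rope_attention \<beta> \<omega> p x = (\<chi> i j. rope_weight \<beta> \<omega> p x i j / rope_degree \<beta> \<omega> p x i)"

text \<open>The vector field is given by its formula on the whole ambient space, not only on the
  product of spheres.\<close>

definition rope_field ::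
    "real \<Rightarrow> ('r::finite \<Rightarrow> real) \<Rightarrow> ('n::finite \<Rightarrow> real)
      \<Rightarrow> (real^('r \<times> 2))^'n \<Rightarrow> (real^('r \<times> 2))^'n" where
  "rope_field \<beta> \<omega> p x =
    (\<chi> i. \<Sum>j\<in>UNIV. rope_attention \<beta> \<omega> p x $ i $ j *\<^sub>R (x $ j - (x $ i \<bullet> x $ j) *\<^sub>R x $ i))"

definition consensus :: "'a \<Rightarrow> 'a^'n" where
  "consensus y = (\<chi> i. y)"

definition sphere_tangent :: "'a::real_inner \<Rightarrow> 'a set" where
  "sphere_tangent y = {\<xi>. \<xi> \<bullet> y = 0}"

definition consensus_tangent :: "'a::real_inner \<Rightarrow> ('a^'n) set" where
  "consensus_tangent y = {\<xi>. \<forall>i. \<xi> $ i \<in> sphere_tangent y}"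

text \<open>The linearization is the ambient Frechet derivative of the vector field; only its values on
  \<open>consensus_tangent y\<close> are of interest.\<close>

definition rope_linearization ::
    "real \<Rightarrow> ('r::finite \<Rightarrow> real) \<Rightarrow> ('n::finite \<Rightarrow> real) \<Rightarrow> real^('r \<times> 2)
      \<Rightarrow> (real^('r \<times> 2))^'n \<Rightarrow> (real^('r \<times> 2))^'n" where
  "rope_linearization \<beta> \<omega> p y = frechet_derivative (rope_field \<beta> \<omega> p) (at (consensus y))"

definition stationary_weight ::
    "real \<Rightarrow> ('r::finite \<Rightarrow> real) \<Rightarrow> ('n::finite \<Rightarrow> real) \<Rightarrow> (real^('r \<times> 2))^'n \<Rightarrow> 'n \<Rightarrow> real" where
  "stationary_weight \<beta> \<omega> p x i = rope_degree \<beta> \<omega> p x i / (\<Sum>k\<in>UNIV. rope_degree \<beta> \<omega> p x k)"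

definition orthonormal_basis_of :: "'a::real_inner set \<Rightarrow> ('k \<Rightarrow> 'a) \<Rightarrow> bool" where
  "orthonormal_basis_of V b \<longleftrightarrow>
    (\<forall>u v. b u \<bullet> b v = (if u = v then 1 else 0)) \<and> span (range b) = V"

text \<open>The basis of the product of \<open>n\<close> copies of a space obtained by using \<open>b\<close> in each copy.\<close>

definition common_basis :: "('k \<Rightarrow> 'a::zero) \<Rightarrow> 'n::finite \<times> 'k \<Rightarrow> 'a^'n" where
  "common_basis b u = axis (fst u) (b (snd u))"

text \<open>\<open>M\<close> is the matrix of the endomorphism of \<open>V\<close> induced by \<open>L\<close>, in the orthonormal basis \<open>e\<close>:
  the column of index \<open>v\<close> holds the coordinates of \<open>L (e v)\<close>.\<close>

definition is_matrix_on ::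
    "'a::real_inner set \<Rightarrow> ('k::finite \<Rightarrow> 'a) \<Rightarrow> ('a \<Rightarrow> 'a) \<Rightarrow> real^'k^'k \<Rightarrow> bool" where
  "is_matrix_on V e L M \<longleftrightarrow>
    orthonormal_basis_of V e \<and> (\<forall>v. L (e v) = (\<Sum>u\<in>UNIV. M $ u $ v *\<^sub>R e u))"

definition kronecker ::
    "real^'n^'m \<Rightarrow> real^'l^'k \<Rightarrow> real^('n::finite \<times> 'l::finite)^('m::finite \<times> 'k::finite)" where
  "kronecker A B = (\<chi> u v. A $ fst u $ fst v * B $ snd u $ snd v)"

end

theory Submission
  imports Defs
begin

text \<open>
  At a consensus state every bracket
  \<open>x $ j - (x $ i \<bullet> x $ j) *\<^sub>R x $ i\<close> vanishes, because \<open>xstar\<close> is a unit vector.  In the product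
  rule the derivative of the attention coefficients is therefore multiplied by zero: all that
  matters about the attention matrix is its value, and that it is differentiable.  What is left is
  the attention average of the derivatives of the brackets, and on tangent vectors those are the
  differences \<open>\<xi> $ j - \<xi> $ i\<close> (\<open>rope_field_has_derivative_at_consensus\<close> and
  \<open>rope_linearization_on_tangent\<close>); the rows of the attention matrix sum to one, which gives
  \<open>A - I\<close>.  This operator mixes the tokens with scalar coefficients and acts identically on all
  coordinates of a tangent vector, whence the Kronecker product with the identity.

  The conservation law is reversibility of the Markov chain with transition matrix \<open>A\<close>.  Scores
  are inner products, hence the weights are symmetric, and the degree of a token times its
  attention to another is a weight: the degrees satisfy detailed balance, so \<open>\<pi>\<close> is stationary
  (\<open>stationary_weight_invariant\<close>).  The derivative of the \<open>\<pi>\<close>-weighted mean along the linear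
  system is then zero, and a function with zero derivative on an interval is constant.
\<close>

section \<open>The attention matrix as a reversible Markov chain\<close>

lemma rope_weight_commute:
  "rope_weight \<beta> \<omega> p x i j = rope_weight \<beta> \<omega> p x j i"
  by (simp add: rope_weight_def rope_score_def inner_commute)

lemma rope_degree_pos: "rope_degree \<beta> \<omega> p x i > 0"
  unfolding rope_degree_def by (rule sum_pos) (auto simp: rope_weight_def)

lemma rope_attention_row_sum: "(\<Sum>j\<in>UNIV. rope_attention \<beta> \<omega> p x $ i $ j) = 1"
  using rope_degree_pos[of \<beta> \<omega> p x i]
  by (simp add: rope_attention_def sum_divide_distrib[symmetric]) (simp add: rope_degree_def)

text \<open>
  Detailed balance: multiplying a row of the attention matrix by its degree undoes the
  normalization, and the weights are symmetric.
\<close>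

lemma stationary_weight_detailed_balance:
  "stationary_weight \<beta> \<omega> p x i * rope_attention \<beta> \<omega> p x $ i $ j
    = stationary_weight \<beta> \<omega> p x j * rope_attention \<beta> \<omega> p x $ j $ i"
  using rope_degree_pos[of \<beta> \<omega> p x i] rope_degree_pos[of \<beta> \<omega> p x j]
    rope_weight_commute[of \<beta> \<omega> p x i j]
  by (simp add: stationary_weight_def rope_attention_def)

lemma stationary_weight_invariant:
  "(\<Sum>i\<in>UNIV. stationary_weight \<beta> \<omega> p x i * rope_attention \<beta> \<omega> p x $ i $ j)
    = stationary_weight \<beta> \<omega> p x j"
proof -
  have "(\<Sum>i\<in>UNIV. stationary_weight \<beta> \<omega> p x i * rope_attention \<beta> \<omega> p x $ i $ j)
      = (\<Sum>i\<in>UNIV. stationary_weight \<beta> \<omega> p x j * rope_attention \<beta> \<omega> p x $ j $ i)"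
    by (intro sum.cong refl stationary_weight_detailed_balance)
  also have "\<dots> = stationary_weight \<beta> \<omega> p x j"
    by (simp add: sum_distrib_left[symmetric] rope_attention_row_sum)
  finally show ?thesis .
qed

text \<open>
  Stationarity says that \<open>\<pi>\<close> is a left null vector of the generator \<open>A - I\<close>; here the
  generator acts on vector-valued entries, the form in which it governs the linear system.
\<close>

lemma stationary_mean_attention_generator:
  fixes \<xi> :: "'a::real_vector^'n::finite"
  shows "(\<Sum>i\<in>UNIV. stationary_weight \<beta> \<omega> p x i *\<^sub>R
    ((\<Sum>j\<in>UNIV. rope_attention \<beta> \<omega> p x $ i $ j *\<^sub>R \<xi> $ j) - \<xi> $ i)) = 0"
proof -
  let ?A = "rope_attention \<beta> \<omega> p x" and ?\<pi> = "stationary_weight \<beta> \<omega> p x"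
  have "(\<Sum>i\<in>UNIV. ?\<pi> i *\<^sub>R (\<Sum>j\<in>UNIV. ?A $ i $ j *\<^sub>R \<xi> $ j))
      = (\<Sum>i\<in>UNIV. \<Sum>j\<in>UNIV. (?\<pi> i * ?A $ i $ j) *\<^sub>R \<xi> $ j)"
    by (simp add: scaleR_sum_right)
  also have "\<dots> = (\<Sum>j\<in>UNIV. \<Sum>i\<in>UNIV. (?\<pi> i * ?A $ i $ j) *\<^sub>R \<xi> $ j)"
    by (rule sum.swap)
  also have "\<dots> = (\<Sum>j\<in>UNIV. ?\<pi> j *\<^sub>R \<xi> $ j)"
    by (simp add: scaleR_sum_left[symmetric] stationary_weight_invariant)
  finally show ?thesis
    by (simp add: scaleR_diff_right sum_subtractf)
qed

section \<open>The derivative of the vector field at consensus\<close>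

lemma rope_weight_differentiable:
  "(\<lambda>x. rope_weight \<beta> \<omega> p x i j) differentiable (at x)"
proof -
  have lin: "(\<lambda>x. rope_rotation \<omega> (p i) *v (x $ i)) differentiable (at x)" for i
    by (intro bounded_linear_imp_differentiable
        bounded_linear_compose[OF matrix_vector_mul_bounded_linear bounded_linear_vec_nth])
  have "(\<lambda>x. \<beta> * rope_score \<omega> p x i j) differentiable (at x)"
    unfolding rope_score_def
    by (intro differentiable_mult differentiable_const differentiable_inner lin)
  then obtain D where D: "((\<lambda>x. \<beta> * rope_score \<omega> p x i j) has_derivative D) (at x)"
    unfolding differentiable_def by blast
  show ?thesis
    unfolding rope_weight_def differentiable_def by (rule exI, rule has_derivative_exp[OF D])
qed

lemma rope_attention_differentiable:
  "(\<lambda>x. rope_attention \<beta> \<omega> p x $ i $ j) differentiable (at x)"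
proof -
  have "rope_degree \<beta> \<omega> p x i \<noteq> 0"
    using rope_degree_pos[of \<beta> \<omega> p x i] by simp
  moreover have "(\<lambda>x. rope_degree \<beta> \<omega> p x i) differentiable (at x)"
    unfolding rope_degree_def 
    by (intro differentiable_sum ballI rope_weight_differentiable finite)
  ultimately show ?thesis
    by (simp add: rope_attention_def rope_weight_differentiable)
qed

lemma has_derivative_vec_lambda:
  fixes f :: "'n::finite \<Rightarrow> 'a::real_normed_vector \<Rightarrow> 'b::euclidean_space"
  assumes "\<And>i. (f i has_derivative f' i) (at x within S)"
  shows "((\<lambda>x. \<chi> i. f i x) has_derivative (\<lambda>h. \<chi> i. f' i h)) (at x within S)"
  unfolding has_derivative_componentwise_within[of "\<lambda>x. \<chi> i. f i x"]
  by (auto simp: Basis_vec_def inner_axis intro!: has_derivative_inner_left assms)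

lemma unit_sphere_inner_self:
  fixes y :: "'a::real_inner"
  assumes "y \<in> sphere 0 1"
  shows "y \<bullet> y = 1"
  using assms by (simp add: dot_square_norm)

text \<open>
  The brackets vanish at a consensus state, so the derivative \<open>D\<close> of the attention coefficient
  survives the product rule only as a multiple of zero.
\<close>

lemma rope_field_has_derivative_at_consensus:
  fixes y :: "real^('r::finite \<times> 2)" and p :: "'n::finite \<Rightarrow> real"
  assumes y: "y \<in> sphere 0 1"
  shows "(rope_field \<beta> \<omega> p has_derivative
    (\<lambda>h. \<chi> i. \<Sum>j\<in>UNIV. rope_attention \<beta> \<omega> p (consensus y) $ i $ j *\<^sub>R
      (h $ j - ((h $ i \<bullet> y + y \<bullet> h $ j) *\<^sub>R y + h $ i)))) (at (consensus y))"
proof -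
  note yy = unit_sphere_inner_self[OF y]
  have summand: "((\<lambda>x. rope_attention \<beta> \<omega> p x $ i $ j *\<^sub>R (x $ j - (x $ i \<bullet> x $ j) *\<^sub>R x $ i))
      has_derivative (\<lambda>h. rope_attention \<beta> \<omega> p (consensus y) $ i $ j *\<^sub>R
        (h $ j - ((h $ i \<bullet> y + y \<bullet> h $ j) *\<^sub>R y + h $ i)))) (at (consensus y))" for i j
  proof -
    have nth: "((\<lambda>x. x $ k) has_derivative (\<lambda>h. h $ k)) (at (consensus y))" for k
      by (rule bounded_linear_imp_has_derivative[OF bounded_linear_vec_nth])
    obtain D where D: "((\<lambda>x. rope_attention \<beta> \<omega> p x $ i $ j) has_derivative D) (at (consensus y))"
      using rope_attention_differentiable unfolding differentiable_def by blast
    show ?thesis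
      by (rule has_derivative_eq_rhs, (rule derivative_intros D nth)+)
        (simp add: consensus_def yy fun_eq_iff algebra_simps)
  qed
  show ?thesis
    unfolding rope_field_def by (intro has_derivative_vec_lambda has_derivative_sum summand)
qed

text \<open>
  The radial terms of the ambient derivative pair a perturbation with \<open>y\<close> and die on tangent
  vectors; the remaining \<open>- \<xi> $ i\<close> is averaged with weights of total mass one.
\<close>

lemma rope_linearization_on_tangent:
  assumes y: "y \<in> sphere 0 1" and \<xi>: "\<xi> \<in> consensus_tangent y"
  shows "rope_linearization \<beta> \<omega> p y \<xi> $ i
    = (\<Sum>j\<in>UNIV. rope_attention \<beta> \<omega> p (consensus y) $ i $ j *\<^sub>R \<xi> $ j) - \<xi> $ i"
proof -
  have "\<xi> $ k \<bullet> y = 0" "y \<bullet> \<xi> $ k = 0" for k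
    using \<xi> by (auto simp: consensus_tangent_def sphere_tangent_def inner_commute)
  then have "rope_linearization \<beta> \<omega> p y \<xi> $ i
      = (\<Sum>j\<in>UNIV. rope_attention \<beta> \<omega> p (consensus y) $ i $ j *\<^sub>R (\<xi> $ j - \<xi> $ i))"
    by (simp add: rope_linearization_def
        frechet_derivative_at[OF rope_field_has_derivative_at_consensus[OF y], symmetric])
  then show ?thesis
    by (simp add: scaleR_diff_right sum_subtractf scaleR_sum_left[symmetric]
        rope_attention_row_sum)
qed

lemma subspace_sphere_tangent: "subspace (sphere_tangent y)"
  by (auto simp: subspace_def sphere_tangent_def inner_left_distrib)

lemma subspace_consensus_tangent: "subspace (consensus_tangent y)"
  by (auto simp: subspace_def consensus_tangent_def sphere_tangent_def inner_left_distrib)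

lemma rope_linearization_preserves_tangent:
  assumes "y \<in> sphere 0 1" and \<xi>: "\<xi> \<in> consensus_tangent y"
  shows "rope_linearization \<beta> \<omega> p y \<xi> \<in> consensus_tangent y"
proof -
  have "\<xi> $ i \<in> sphere_tangent y" for i
    using \<xi> by (simp add: consensus_tangent_def)
  then have "rope_linearization \<beta> \<omega> p y \<xi> $ i \<in> sphere_tangent y" for i
    unfolding rope_linearization_on_tangent[OF assms]
    by (intro subspace_diff subspace_sum subspace_scale subspace_sphere_tangent)
  then show ?thesis by (simp add: consensus_tangent_def)
qed

section \<open>The Jacobian in a common orthonormal basis\<close>

lemma orthonormal_basis_of_card:
  fixes b :: "'k::finite \<Rightarrow> 'a::euclidean_space"
  assumes "orthonormal_basis_of V b"
  shows "CARD('k) = dim V"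
proof -
  have orth: "b u \<bullet> b v = (if u = v then 1 else 0)" for u v
    using assms by (simp add: orthonormal_basis_of_def)
  have inj: "inj b"
    by (rule injI) (metis orth zero_neq_one)
  have "0 \<notin> range b"
    by (metis orth imageE inner_zero_left zero_neq_one)
  moreover have "pairwise orthogonal (range b)"
    by (auto simp: pairwise_def orthogonal_def orth)
  ultimately have "independent (range b)"
    by (rule pairwise_orthogonal_independent[rotated])
  then have "dim (span (range b)) = card (range b)"
    by (rule dim_span_eq_card_independent)
  moreover have "span (range b) = V"
    using assms by (simp add: orthonormal_basis_of_def)
  ultimately show ?thesis
    using card_image[OF inj] by simp
qed

lemma dim_sphere_tangent:
  fixes y :: "'a::euclidean_space"
  assumes "y \<in> sphere 0 1"
  shows "dim (sphere_tangent y) = DIM('a) - 1"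
proof -
  have "y \<noteq> 0" using assms by auto
  then show ?thesis
    using dim_hyperplane[of y] by (simp add: sphere_tangent_def inner_commute)
qed

lemma linear_axis: "linear (axis i :: 'a::real_vector \<Rightarrow> 'a^'n::finite)"
  by (rule linearI) (auto simp: vec_eq_iff axis_def)

text \<open>
  Spanning holds because a configuration is the sum of its entries, each placed on its own axis by
  a linear map, and linear maps commute with spans.
\<close>

lemma orthonormal_basis_of_consensus_tangent:
  fixes y :: "'a::real_inner" and b :: "'k::finite \<Rightarrow> 'a"
  assumes b: "orthonormal_basis_of (sphere_tangent y) b"
  shows "orthonormal_basis_of (consensus_tangent y :: ('a^'n::finite) set) (common_basis b)"
proof -
  let ?e = "common_basis b :: 'n \<times> 'k \<Rightarrow> 'a^'n"
  have orth: "b u \<bullet> b v = (if u = v then 1 else 0)" for u v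
    using b by (simp add: orthonormal_basis_of_def)
  have span_b: "span (range b) = sphere_tangent y"
    using b by (simp add: orthonormal_basis_of_def)
  have "?e u \<bullet> ?e v = (if u = v then 1 else 0)" for u v
    by (cases u; cases v) (auto simp: common_basis_def inner_axis_axis orth)
  moreover have "span (range ?e) \<subseteq> consensus_tangent y"
  proof (rule span_minimal[OF _ subspace_consensus_tangent])
    have "b k \<in> sphere_tangent y" for k
      unfolding span_b[symmetric] by (simp add: span_base)
    then show "range ?e \<subseteq> consensus_tangent y"
      by (auto simp: consensus_tangent_def common_basis_def axis_def
          subspace_0[OF subspace_sphere_tangent])
  qed
  moreover have "consensus_tangent y \<subseteq> span (range ?e)"
  proof
    fix \<xi> :: "'a^'n" assume \<xi>: "\<xi> \<in> consensus_tangent y"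
    have "axis i (\<xi> $ i) \<in> span (range ?e)" for i
    proof -
      have "\<xi> $ i \<in> span (range b)"
        using \<xi> by (simp add: span_b consensus_tangent_def)
      then have "axis i (\<xi> $ i) \<in> span (axis i ` range b)"
        by (simp add: linear_span_image[OF linear_axis])
      moreover have "axis i ` range b \<subseteq> range ?e"
      proof clarify
        fix k
        have "axis i (b k) = ?e (i, k)" by (simp add: common_basis_def)
        then show "axis i (b k) \<in> range ?e" by (metis rangeI)
      qed
      ultimately show ?thesis
        using span_mono by blast
    qed
    then have "(\<Sum>i\<in>UNIV. axis i (\<xi> $ i)) \<in> span (range ?e)"
      by (intro span_sum)
    moreover have "(\<Sum>i\<in>UNIV. axis i (\<xi> $ i)) = \<xi>"
      by (simp add: vec_eq_iff axis_def)
    ultimately show "\<xi> \<in> span (range ?e)" by simp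
  qed
  ultimately show ?thesis
    unfolding orthonormal_basis_of_def by blast
qed

text \<open>
  An operator that mixes the entries of a vector with scalar coefficients \<open>M\<close> sends a basis vector
  supported on one entry to multiples of the same \<open>b k\<close> in every entry: the identity factor of the
  Kronecker product records that \<open>k\<close> does not change.
\<close>

lemma kronecker_mat_1_common_basis:
  fixes M :: "real^'n::finite^'n" and b :: "'k::finite \<Rightarrow> 'a::real_vector"
  shows "(\<Sum>u\<in>UNIV. kronecker M (mat 1 :: real^'k^'k) $ u $ (j, k) *\<^sub>R common_basis b u)
    = (\<chi> i. M $ i $ j *\<^sub>R b k)"
proof -
  have "(\<Sum>u\<in>UNIV. kronecker M (mat 1 :: real^'k^'k) $ u $ (j, k) *\<^sub>R common_basis b u)
      = (\<Sum>i\<in>UNIV. \<Sum>l\<in>UNIV. (M $ i $ j * (if l = k then 1 else 0)) *\<^sub>R axis i (b l))"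
    unfolding sum.cartesian_product
    by (intro sum.cong) (auto simp: kronecker_def common_basis_def mat_def)
  also have "\<dots> = (\<Sum>i\<in>UNIV. M $ i $ j *\<^sub>R axis i (b k))"
  proof (rule sum.cong)
    fix i :: 'n
    have "(\<Sum>l\<in>UNIV. (M $ i $ j * (if l = k then 1 else 0)) *\<^sub>R axis i (b l))
        = (\<Sum>l\<in>UNIV. if l = k then M $ i $ j *\<^sub>R (axis i (b l) :: 'a^'n) else 0)"
      by (intro sum.cong) auto
    then show "(\<Sum>l\<in>UNIV. (M $ i $ j * (if l = k then 1 else 0)) *\<^sub>R (axis i (b l) :: 'a^'n))
        = M $ i $ j *\<^sub>R axis i (b k)"
      by simp
  qed simp
  also have "\<dots> = (\<chi> i. M $ i $ j *\<^sub>R b k)"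
    by (simp add: vec_eq_iff axis_def if_distrib[of "\<lambda>x. _ *\<^sub>R x"] cong: if_cong)
  finally show ?thesis .
qed

lemma rope_linearization_matrix:
  fixes y :: "real^('r::finite \<times> 2)" and p :: "'n::finite \<Rightarrow> real"
    and b :: "'k::finite \<Rightarrow> real^('r \<times> 2)"
  assumes y: "y \<in> sphere 0 1" and b: "orthonormal_basis_of (sphere_tangent y) b"
  shows "is_matrix_on (consensus_tangent y) (common_basis b) (rope_linearization \<beta> \<omega> p y)
    (kronecker (rope_attention \<beta> \<omega> p (consensus y) - mat 1) (mat 1 :: real^'k^'k))"
  unfolding is_matrix_on_def
proof (intro conjI allI)
  show e: "orthonormal_basis_of (consensus_tangent y) (common_basis b :: 'n \<times> 'k \<Rightarrow> _)"
    by (rule orthonormal_basis_of_consensus_tangent[OF b])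
  fix v :: "'n \<times> 'k"
  obtain j k where v: "v = (j, k)" by (cases v)
  let ?A = "rope_attention \<beta> \<omega> p (consensus y)"
  have tangent: "common_basis b v \<in> consensus_tangent y"
    using e unfolding orthonormal_basis_of_def by (metis rangeI span_base)
  have "rope_linearization \<beta> \<omega> p y (common_basis b v) $ i = (?A - mat 1) $ i $ j *\<^sub>R b k" for i
    unfolding rope_linearization_on_tangent[OF y tangent]
    by (simp add: v common_basis_def axis_def mat_def scaleR_diff_left
        if_distrib[of "\<lambda>x. _ *\<^sub>R x"] cong: if_cong)
  then show "rope_linearization \<beta> \<omega> p y (common_basis b v)
      = (\<Sum>u\<in>UNIV. kronecker (?A - mat 1) (mat 1 :: real^'k^'k) $ u $ v *\<^sub>R common_basis b u)"
    by (simp add: v kronecker_mat_1_common_basis vec_eq_iff)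
qed

section \<open>Conservation of the stationary mean\<close>

lemma stationary_mean_conserved:
  fixes y :: "real^('r::finite \<times> 2)" and \<xi> :: "real \<Rightarrow> (real^('r \<times> 2))^'n::finite"
  assumes y: "y \<in> sphere 0 1" and I: "is_interval I" "s \<in> I" "t \<in> I"
    and tangent: "\<And>t. t \<in> I \<Longrightarrow> \<xi> t \<in> consensus_tangent y"
    and sol: "\<And>t. t \<in> I \<Longrightarrow>
      (\<xi> has_vector_derivative rope_linearization \<beta> \<omega> p y (\<xi> t)) (at t within I)"
  shows "(\<Sum>i\<in>UNIV. stationary_weight \<beta> \<omega> p (consensus y) i *\<^sub>R \<xi> s $ i)
    = (\<Sum>i\<in>UNIV. stationary_weight \<beta> \<omega> p (consensus y) i *\<^sub>R \<xi> t $ i)"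
proof -
  let ?m = "\<lambda>x :: (real^('r \<times> 2))^'n.
    \<Sum>i\<in>UNIV. stationary_weight \<beta> \<omega> p (consensus y) i *\<^sub>R x $ i"
  have lin: "bounded_linear ?m"
    by (intro bounded_linear_sum bounded_linear_const_scaleR bounded_linear_vec_nth)
  have "((\<lambda>t. ?m (\<xi> t)) has_vector_derivative 0) (at t within I)" if "t \<in> I" for t
    using bounded_linear.has_vector_derivative[OF lin sol[OF that]]
    by (simp add: rope_linearization_on_tangent[OF y tangent[OF that]]
        stationary_mean_attention_generator)
  then obtain c where "\<And>t. t \<in> I \<Longrightarrow> ?m (\<xi> t) = c"
    using has_vector_derivative_zero_constant[of I "\<lambda>t. ?m (\<xi> t)"] I(1)
    by (auto simp: is_interval_convex)
  then show ?thesis using I by simp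
qed

theorem theorem4p3:
  fixes \<beta> :: real
    and \<omega> :: "'r::finite \<Rightarrow> real"
    and p :: "'n::finite \<Rightarrow> real"
    and xstar :: "real^('r \<times> 2)"
  defines "X \<equiv> (consensus xstar :: (real^('r \<times> 2))^'n)"
    and "L \<equiv> rope_linearization \<beta> \<omega> p xstar"
    and "A \<equiv> rope_attention \<beta> \<omega> p (consensus xstar)"
    and "\<pi> \<equiv> stationary_weight \<beta> \<omega> p (consensus xstar)"
  assumes "CARD('n) \<ge> 2"
    and "\<beta> \<ge> 0"
    and "xstar \<in> sphere 0 1"
  shows "rope_field \<beta> \<omega> p X = 0 \<and>
    rope_field \<beta> \<omega> p differentiable (at X) \<and>
    (\<forall>\<xi> \<in> consensus_tangent xstar.
       L \<xi> \<in> consensus_tangent xstar \<and>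
       (\<forall>i. L \<xi> $ i = (\<Sum>j\<in>UNIV. A $ i $ j *\<^sub>R \<xi> $ j) - \<xi> $ i)) \<and>
    (\<forall>b :: 'k::finite \<Rightarrow> real^('r \<times> 2). orthonormal_basis_of (sphere_tangent xstar) b \<longrightarrow>
       CARD('k) = 2 * CARD('r) - 1 \<and>
       is_matrix_on (consensus_tangent xstar) (common_basis b) L
         (kronecker (A - mat 1) (mat 1 :: real^'k^'k))) \<and>
    (\<forall>I (\<xi> :: real \<Rightarrow> (real^('r \<times> 2))^'n). is_interval I \<and>
       (\<forall>t\<in>I. \<xi> t \<in> consensus_tangent xstar \<and>
               (\<xi> has_vector_derivative L (\<xi> t)) (at t within I)) \<longrightarrow>
       (\<forall>s\<in>I. \<forall>t\<in>I. (\<Sum>i\<in>UNIV. \<pi> i *\<^sub>R \<xi> s $ i) = (\<Sum>i\<in>UNIV. \<pi> i *\<^sub>R \<xi> t $ i)))"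
proof -
  note y = \<open>xstar \<in> sphere 0 1\<close>
  have "rope_field \<beta> \<omega> p X = 0"
    using unit_sphere_inner_self[OF y]
    by (simp add: X_def rope_field_def consensus_def vec_eq_iff)
  moreover have "rope_field \<beta> \<omega> p differentiable (at X)"
    unfolding X_def differentiable_def
    using rope_field_has_derivative_at_consensus[OF y] by blast
  moreover have "CARD('k) = 2 * CARD('r) - 1"
    if "orthonormal_basis_of (sphere_tangent xstar) b" for b :: "'k \<Rightarrow> real^('r \<times> 2)"
    using orthonormal_basis_of_card[OF that] dim_sphere_tangent[OF y]
    by (simp add: mult.commute)
  ultimately show ?thesis
    unfolding L_def A_def \<pi>_def
    using rope_linearization_preserves_tangent[OF y] rope_linearization_on_tangent[OF y]
      rope_linearization_matrix[OF y]
    by (auto intro!: stationary_mean_conserved[OF y])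
qed

end
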